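(* Let $k\ge 2$ and let $$P(t)=1+\sum_{n\ge1}\frac{p^{\binom n2}(-t)^n}{[n]_{p,q}!}c_n,\quad G(t)=\sum_{n\ge2}(n-1)\frac{p^{\binom n2}(-t)^n}{[n]_{p,q}!}c_n,\quad H(t)=-\sum_{n\ge3}\binom{n-1}{2}\frac{p^{\binom n2}(-t)^n}{[n]_{p,q}!}c_n,$$ where $c_n=\begin{bmatrix} n+k-1\\ n\end{bmatrix}_r$. Then $$\sum_{n\ge0}\frac{t^n}{[n]_{p,q}!}\sum_{(\sigma,w)\in\mathcal{U}_{n,k}}q^{\mathrm{inv}(\sigma)}p^{\mathrm{coinv}(\sigma)}r^{\|w\|}=\frac{([k]_rt-1)+P(t)-G(t)}{P(t)^2}$$ and $$\sum_{n\ge0}\frac{t^n}{[n]_{p,q}!}\sum_{(\sigma,w)\in\mathcal{V}_{n,k}}q^{\mathrm{inv}(\sigma)}p^{\mathrm{coinv}(\sigma)}r^{\|w\|}=\frac{G(t)^2+P(t)\big(H(t)+G(t)-([k]_rt-1)-P(t)\big)}{P(t)^3}.$$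
   Context: $C_k\wr S_n$ is identified with the set of pairs $(\sigma,w)$, $\sigma\in S_n$, $w=w_1\cdots w_n\in\{0,\dots,k-1\}^n$. The rise set is $\mathrm{Ris}(\sigma,w)=\{i\le n-1:\sigma_i<\sigma_{i+1},\ w_i\le w_{i+1}\}$. $\mathcal{U}_{n,k}$ is the set of $(\sigma,w)\in C_k\wr S_n$ with $\mathrm{Ris}(\sigma,w)=\{s,s+1\}$ for some $1\le s\le n-2$; $\mathcal{V}_{n,k}$ is the set of $(\sigma,w)\in C_k\wr S_n$ with $\mathrm{Ris}(\sigma,w)=\{i,j\}$ for some $i+2\le j$. $\mathrm{inv}(\sigma)=|\{a<b:\sigma_a>\sigma_b\}|$, $\mathrm{coinv}(\sigma)=|\{a<b:\sigma_a<\sigma_b\}|$, $\|w\|=w_1+\cdots+w_n$. $[n]_{p,q}=p^{n-1}+\cdots+q^{n-1}$, $[n]_{p,q}!=[n]_{p,q}\cdots[1]_{p,q}$; $[n]_r=1+r+\cdots+r^{n-1}$, $[k]_r=1+r+\cdots+r^{k-1}$, $[n]_r!=[n]_r\cdots[1]_r$, $\begin{bmatrix} a\\ b\end{bmatrix}_r=\frac{[a]_r!}{[b]_r![a-b]_r!}$. *)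

theory Defs
  imports
    "HOL-Computational_Algebra.Computational_Algebra"
    "HOL-Combinatorics.Permutations"
    "HOL-Library.FuncSet"
begin

definition pq_num :: "'a::comm_ring_1 \<Rightarrow> 'a \<Rightarrow> nat \<Rightarrow> 'a" where
  "pq_num p q n = (\<Sum>i<n. p ^ (n - 1 - i) * q ^ i)"

definition pq_fact :: "'a::comm_ring_1 \<Rightarrow> 'a \<Rightarrow> nat \<Rightarrow> 'a" where
  "pq_fact p q n = (\<Prod>i=1..n. pq_num p q i)"

definition q_num :: "'a::comm_ring_1 \<Rightarrow> nat \<Rightarrow> 'a" where
  "q_num r n = (\<Sum>i<n. r ^ i)"

definition q_fact :: "'a::comm_ring_1 \<Rightarrow> nat \<Rightarrow> 'a" where
  "q_fact r n = (\<Prod>i=1..n. q_num r i)"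

definition q_binom :: "'a::field \<Rightarrow> nat \<Rightarrow> nat \<Rightarrow> 'a" where
  "q_binom r a b = q_fact r a / (q_fact r b * q_fact r (a - b))"

text \<open>
  A permutation is a bijection of \<open>{1..n}\<close> extended by the identity; a word is a function
  on \<open>{1..n}\<close> extended by \<open>undefined\<close>. Hence each pair of the wreath product has exactly one
  representation.
\<close>

definition wreath :: "nat \<Rightarrow> nat \<Rightarrow> ((nat \<Rightarrow> nat) \<times> (nat \<Rightarrow> nat)) set" where
  "wreath k n = {\<sigma>. \<sigma> permutes {1..n}} \<times> ({1..n} \<rightarrow>\<^sub>E {0..<k})"

definition Ris :: "nat \<Rightarrow> (nat \<Rightarrow> nat) \<Rightarrow> (nat \<Rightarrow> nat) \<Rightarrow> nat set" where
  "Ris n \<sigma> w = {i. 1 \<le> i \<and> i + 1 \<le> n \<and> \<sigma> i < \<sigma> (i + 1) \<and> w i \<le> w (i + 1)}"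

definition inv_stat :: "nat \<Rightarrow> (nat \<Rightarrow> nat) \<Rightarrow> nat" where
  "inv_stat n \<sigma> = card {(a, b). 1 \<le> a \<and> a < b \<and> b \<le> n \<and> \<sigma> a > \<sigma> b}"

definition coinv_stat :: "nat \<Rightarrow> (nat \<Rightarrow> nat) \<Rightarrow> nat" where
  "coinv_stat n \<sigma> = card {(a, b). 1 \<le> a \<and> a < b \<and> b \<le> n \<and> \<sigma> a < \<sigma> b}"

definition word_sum :: "nat \<Rightarrow> (nat \<Rightarrow> nat) \<Rightarrow> nat" where
  "word_sum n w = (\<Sum>i=1..n. w i)"

definition U_set :: "nat \<Rightarrow> nat \<Rightarrow> ((nat \<Rightarrow> nat) \<times> (nat \<Rightarrow> nat)) set" where
  "U_set n k = {(\<sigma>, w) \<in> wreath k n. \<exists>s. 1 \<le> s \<and> s + 2 \<le> n \<and> Ris n \<sigma> w = {s, s + 1}}"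

definition V_set :: "nat \<Rightarrow> nat \<Rightarrow> ((nat \<Rightarrow> nat) \<times> (nat \<Rightarrow> nat)) set" where
  "V_set n k = {(\<sigma>, w) \<in> wreath k n. \<exists>i j. i + 2 \<le> j \<and> Ris n \<sigma> w = {i, j}}"

definition weight_gf ::
  "'a::field \<Rightarrow> 'a \<Rightarrow> 'a \<Rightarrow> (nat \<Rightarrow> ((nat \<Rightarrow> nat) \<times> (nat \<Rightarrow> nat)) set) \<Rightarrow> 'a fps" where
  "weight_gf p q r A = Abs_fps (\<lambda>n.
     (\<Sum>(\<sigma>, w)\<in>A n. q ^ inv_stat n \<sigma> * p ^ coinv_stat n \<sigma> * r ^ word_sum n w) / pq_fact p q n)"

definition base_coeff :: "'a::field \<Rightarrow> 'a \<Rightarrow> 'a \<Rightarrow> nat \<Rightarrow> nat \<Rightarrow> 'a" where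
  "base_coeff p q r k n =
     p ^ (n choose 2) * (- 1) ^ n / pq_fact p q n * q_binom r (n + k - 1) n"

definition P_fps :: "'a::field \<Rightarrow> 'a \<Rightarrow> 'a \<Rightarrow> nat \<Rightarrow> 'a fps" where
  "P_fps p q r k = 1 + Abs_fps (\<lambda>n. if n \<ge> 1 then base_coeff p q r k n else 0)"

definition G_fps :: "'a::field \<Rightarrow> 'a \<Rightarrow> 'a \<Rightarrow> nat \<Rightarrow> 'a fps" where
  "G_fps p q r k =
     Abs_fps (\<lambda>n. if n \<ge> 2 then of_nat (n - 1) * base_coeff p q r k n else 0)"

definition H_fps :: "'a::field \<Rightarrow> 'a \<Rightarrow> 'a \<Rightarrow> nat \<Rightarrow> 'a fps" where
  "H_fps p q r k =
     - Abs_fps (\<lambda>n. if n \<ge> 3 then of_nat ((n - 1) choose 2) * base_coeff p q r k n else 0)"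

text \<open>
  The generating function identities are stated for elements \<open>p\<close>, \<open>q\<close>, \<open>r\<close> of a field of
  characteristic 0 at which no denominator vanishes. This covers positive reals, and also three
  independent indeterminates: the iterated polynomial ring is ordered by the sign of the leading
  coefficient, which makes its field of fractions an ordered field with positive indeterminates.
\<close>

lemma pq_num_pos:
  fixes p q :: "'a::linordered_field"
  assumes "p > 0" "q > 0" "n \<ge> 1"
  shows "pq_num p q n > 0"
  using assms unfolding pq_num_def by (intro sum_pos) (auto simp: lessThan_empty_iff)

lemma q_num_pos:
  fixes r :: "'a::linordered_field"
  assumes "r > 0" "n \<ge> 1"
  shows "q_num r n > 0"
  using assms unfolding q_num_def by (intro sum_pos) (auto simp: lessThan_empty_iff)

lemma indeterminates_pos:
  "0 < Fract [:[:[:0, 1::int:]:]:] 1"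
  "0 < Fract [:[:0, 1::int poly:]:] 1"
  "0 < Fract [:0, 1::int poly poly:] 1"
  by (simp_all add: Fraction_Field.zero_less_Fract_iff less_poly_def pos_poly_def)

end

theory Submission
  imports Defs
begin

text \<open>
  Encode the rise set of \<open>(\<sigma>, w)\<close> as a word over \<open>{F, T}\<close> of length \<open>n - 1\<close>, and let \<open>\<alpha>(u)\<close> be
  the total weight of the pairs with rise word \<open>u\<close>, divided by \<open>[n]\<^bsub>p,q\<^esub>!\<close>. Cutting a pair into a
  prefix and a suffix and standardising both gives the ribbon product rule
  \<open>\<alpha>(u) \<alpha>(v) = \<alpha>(u F v) + \<alpha>(u T v)\<close>, where the \<open>p,q\<close>-binomial coefficient counting the ways to
  shuffle the values is absorbed by the factorials. Moreover \<open>\<alpha>(T\<^bsup>n-1\<^esup>)\<close> is, up to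
  sign, the coefficient of \<open>t\<^sup>n\<close> in \<open>P\<close>. By the product rule, multiplying a generating function
  by \<open>P\<close> telescopes: a run of \<open>F\<close> at the end of a word is replaced by a run of \<open>T\<close> with alternating
  sign. Doing this at both ends of \<open>F\<^sup>i T T F\<^sup>j\<close> leaves only the words \<open>T\<^sup>m\<close> and yields the first
  identity. For \<open>F\<^sup>i T F\<^sup>l T F\<^sup>j\<close> the inner run is removed by summation by parts, which
  produces the extra factors \<open>G\<close> and \<open>P\<close>.
\<close>

subsection \<open>Functions on rise words with the ribbon product rule\<close>

text \<open>The formal power series \<open>\<Sum>\<^sub>i X\<^sup>i F\<^sub>i\<close>.\<close>

definition diag_sum :: "(nat \<Rightarrow> 'a::comm_ring_1 fps) \<Rightarrow> 'a fps" where
  "diag_sum F = Abs_fps (\<lambda>n. \<Sum>i\<le>n. F i $ (n - i))"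

lemma diag_sum_nth: "diag_sum F $ n = (\<Sum>i\<le>n. F i $ (n - i))"
  by (simp add: diag_sum_def)

text \<open>The summand with index \<open>i\<close> starts in degree \<open>i\<close>, so truncating
  at \<open>N\<close> is exact up to degree \<open>N\<close>. This reduces products with the
  infinite sum to finite distributivity.\<close>

lemma diag_sum_nth_eq:
  assumes "n \<le> N"
  shows "diag_sum F $ n = (\<Sum>i\<le>N. fps_X ^ i * F i) $ n"
proof -
  have "(\<Sum>i\<le>N. fps_X ^ i * F i) $ n = (\<Sum>i\<le>N. if n < i then 0 else F i $ (n - i))"
    by (simp add: fps_sum_nth fps_X_power_mult_nth)
  also have "\<dots> = (\<Sum>i\<le>n. F i $ (n - i))"
    by (rule sum.mono_neutral_cong_right) (use assms in auto)
  finally show ?thesis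
    by (simp add: diag_sum_nth)
qed

lemma diag_sum_mult: "diag_sum (\<lambda>i. F i * P) = diag_sum F * P"
proof (rule fps_ext)
  fix n
  have "diag_sum (\<lambda>i. F i * P) $ n = ((\<Sum>i\<le>n. fps_X ^ i * F i) * P) $ n"
    by (subst diag_sum_nth_eq[OF order_refl]) (simp add: sum_distrib_right mult.assoc)
  also have "\<dots> = (diag_sum F * P) $ n"
    unfolding fps_mult_nth by (intro sum.cong) (auto simp: diag_sum_nth_eq)
  finally show "diag_sum (\<lambda>i. F i * P) $ n = (diag_sum F * P) $ n" .
qed

lemma diag_sum_diff: "diag_sum (\<lambda>i. F i - G i) = diag_sum F - diag_sum G"
  by (rule fps_ext) (simp add: diag_sum_nth sum_subtractf)

text \<open>Both sides sum \<open>f i j\<close> along \<open>i + j = n\<close>. The swap selects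
  which of two runs is the inner series, the only one that \<open>right_falses\<close> or
  \<open>left_falses\<close> can act on.\<close>

lemma diag_sum_swap:
  "diag_sum (\<lambda>i. Abs_fps (f i)) = diag_sum (\<lambda>j. Abs_fps (\<lambda>i. f i j))"
proof (rule fps_ext)
  fix n
  show "diag_sum (\<lambda>i. Abs_fps (f i)) $ n = diag_sum (\<lambda>j. Abs_fps (\<lambda>i. f i j)) $ n"
    by (simp add: diag_sum_nth,
        rule sum.reindex_bij_witness[where i = "\<lambda>i. n - i" and j = "\<lambda>i. n - i"]) auto
qed

text \<open>The hockey-stick identity; truncated subtraction makes the term at \<open>i = 0\<close>
  vanish. It evaluates the weights \<open>i - 1\<close> left behind by the inner run.\<close>

lemma sum_of_nat_pred: "(\<Sum>i<n. of_nat (i - 1)) = (of_nat ((n - 1) choose 2) :: 'b::comm_semiring_1)"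
proof (induction n)
  case (Suc n)
  then show ?case
    by (cases n) (simp_all add: numeral_2_eq_2 add.commute flip: of_nat_add)
qed (simp add: numeral_2_eq_2)

text \<open>Isolating the product rule lets the telescoping argument be instantiated a second time
  for reversed words.\<close>

locale ribbon =
  fixes \<alpha> :: "bool list \<Rightarrow> 'a::comm_ring_1"
  assumes mult: "\<alpha> u * \<alpha> v = \<alpha> (u @ False # v) + \<alpha> (u @ True # v)"
begin

abbreviation F :: "nat \<Rightarrow> bool list" where "F n \<equiv> replicate n False"
abbreviation T :: "nat \<Rightarrow> bool list" where "T n \<equiv> replicate n True"

text \<open>A word of length \<open>n - 1\<close> describes arrangements of \<open>n\<close>
  letters, hence the separate constant term at \<open>n = 0\<close>.\<close>

definition b :: "nat \<Rightarrow> 'a" where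
  "b n = (if n = 0 then 1 else (- 1) ^ n * \<alpha> (T (n - 1)))"

definition P :: "'a fps" where "P = Abs_fps b"

text \<open>Truncated subtraction gives coefficient 0 at both \<open>n = 0\<close> and
  \<open>n = 1\<close>, as in \<open>G_fps\<close>.\<close>

definition G :: "'a fps" where "G = Abs_fps (\<lambda>n. of_nat (n - 1) * b n)"

text \<open>With \<open>Z N = (-1)\<^sup>N \<alpha> (u F\<^bsup>K-N\<^esup> T\<^sup>N)\<close>, the product rule says that the
  increment \<open>Z N - Z (N - 1)\<close> is \<open>\<alpha> (u F\<^bsup>K-N\<^esup>) b N\<close>.\<close>

lemma partial_convolution:
  assumes "N \<le> K"
  shows "(\<Sum>i\<le>N. \<alpha> (u @ F (K - i)) * b i) = (- 1) ^ N * \<alpha> (u @ F (K - N) @ T N)"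
  using assms
proof (induction N)
  case 0
  show ?case by (simp add: b_def)
next
  case (Suc N)
  have "\<alpha> (u @ F (K - Suc N)) * \<alpha> (T N) =
      \<alpha> (u @ F (K - N) @ T N) + \<alpha> (u @ F (K - Suc N) @ T (Suc N))"
  proof -
    \<comment> \<open>Detaching the last \<open>False\<close> exhibits the word for \<open>N\<close>
      as the \<open>False\<close> branch of the product rule; the word for \<open>Suc N\<close> is
      the \<open>True\<close> branch.\<close>
    have "F (K - N) = F (K - Suc N) @ [False]"
      using Suc.prems by (metis Suc_diff_Suc Suc_le_lessD replicate_Suc replicate_append_same)
    then show ?thesis by (subst mult) simp
  qed
  then have "\<alpha> (u @ F (K - Suc N)) * b (Suc N) = (- 1) ^ Suc N *
      (\<alpha> (u @ F (K - N) @ T N) + \<alpha> (u @ F (K - Suc N) @ T (Suc N)))"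
    by (simp add: b_def mult.left_commute)
  with Suc show ?case
    by (simp add: distrib_left)
qed

text \<open>The case \<open>N = K\<close> of \<open>partial_convolution\<close>: the complete
  convolution leaves no \<open>False\<close> in the final run.\<close>

lemma right_falses:
  "Abs_fps (\<lambda>j. \<alpha> (u @ F j)) * P = Abs_fps (\<lambda>N. (- 1) ^ N * \<alpha> (u @ T N))"
proof (rule fps_ext)
  fix n
  have "(Abs_fps (\<lambda>j. \<alpha> (u @ F j)) * P) $ n = (\<Sum>i\<le>n. \<alpha> (u @ F (n - i)) * b i)"
    by (subst mult.commute) (simp add: P_def fps_mult_nth atLeast0AtMost mult.commute)
  also have "\<dots> = (- 1) ^ n * \<alpha> (u @ T n)"
    by (subst partial_convolution) auto
  finally show "(Abs_fps (\<lambda>j. \<alpha> (u @ F j)) * P) $ n =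
      Abs_fps (\<lambda>N. (- 1) ^ N * \<alpha> (u @ T N)) $ n" by simp
qed

end

text \<open>Reversal exchanges the two factors of the product rule, which is harmless in a
  commutative ring.\<close>

lemma ribbon_rev:
  assumes "ribbon \<alpha>"
  shows "ribbon (\<lambda>u. \<alpha> (rev u))"
  using assms by (simp add: ribbon_def) (metis mult.commute)

context ribbon
begin

text \<open>The mirror image of \<open>right_falses\<close>. The series \<open>P\<close> is the same
  for the reversed function because the words \<open>T m\<close> are palindromes.\<close>

lemma left_falses:
  "Abs_fps (\<lambda>j. \<alpha> (F j @ u)) * P = Abs_fps (\<lambda>N. (- 1) ^ N * \<alpha> (T N @ u))"
proof -
  interpret R: ribbon "\<lambda>u. \<alpha> (rev u)"
    by (rule ribbon_rev) unfold_locales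
  have "R.P = P"
    by (rule fps_ext) (simp add: R.P_def P_def R.b_def b_def)
  then show ?thesis
    using R.right_falses[of "rev u"] by simp
qed

text \<open>Each outer run costs one factor \<open>P\<close>. What remains are the words
  \<open>T M @ T 2 @ T N\<close> with sign exponent \<open>M + N = n\<close>; these
  \<open>n + 1\<close> terms coincide.\<close>

lemma adjacent_pair_gf:
  "diag_sum (\<lambda>i. Abs_fps (\<lambda>j. \<alpha> (F i @ T 2 @ F j))) * P ^ 2 =
     Abs_fps (\<lambda>n. of_nat (n + 1) * (- 1) ^ n * \<alpha> (T (n + 2)))"
proof -
  have "diag_sum (\<lambda>i. Abs_fps (\<lambda>j. \<alpha> (F i @ T 2 @ F j))) * P =
      diag_sum (\<lambda>i. Abs_fps (\<lambda>N. (- 1) ^ N * \<alpha> (F i @ T 2 @ T N)))"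
    using right_falses[of "F _ @ T 2"] by (simp flip: diag_sum_mult)
  also have "\<dots> = diag_sum (\<lambda>N. fps_const ((- 1) ^ N) * Abs_fps (\<lambda>i. \<alpha> (F i @ T 2 @ T N)))"
    by (subst diag_sum_swap) (simp add: fps_const_mult_left)
  also have "\<dots> * P = diag_sum (\<lambda>N. fps_const ((- 1) ^ N) *
      Abs_fps (\<lambda>M. (- 1) ^ M * \<alpha> (T M @ T 2 @ T N)))"
    by (simp flip: diag_sum_mult add: left_falses mult.assoc)
  also have "\<dots> = Abs_fps (\<lambda>n. of_nat (n + 1) * (- 1) ^ n * \<alpha> (T (n + 2)))"
  proof (rule fps_ext)
    fix n
    have *: "T M @ T 2 @ T N = T (M + N + 2)" for M N
      by (rule replicate_eqI) auto
    have "(\<Sum>i\<le>n. (- 1) ^ i * ((- 1) ^ (n - i) * \<alpha> (T (n - i) @ T 2 @ T i))) =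
        (\<Sum>i\<le>n. (- 1) ^ n * \<alpha> (T (n + 2)))"
      unfolding * by (rule sum.cong) (auto simp flip: power_add mult.assoc)
    then show "diag_sum (\<lambda>N. fps_const ((- 1) ^ N) *
        Abs_fps (\<lambda>M. (- 1) ^ M * \<alpha> (T M @ T 2 @ T N))) $ n =
        Abs_fps (\<lambda>n. of_nat (n + 1) * (- 1) ^ n * \<alpha> (T (n + 2))) $ n"
      by (simp add: diag_sum_nth algebra_simps)
  qed
  finally show ?thesis
    by (simp add: power2_eq_square mult.assoc)
qed

text \<open>Up to sign, the words \<open>F (l + 1) @ T (N + 1)\<close> after \<open>u\<close> are
  proper partial sums of the convolution of \<open>b\<close> with \<open>\<alpha> (u @ F j)\<close>.
  Summing these partial sums by parts produces the weights \<open>i - 1\<close> of \<open>G\<close>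
  and one boundary term. The factor \<open>fps_X ^ 2\<close> makes the degree equal to the length
  \<open>K = l + N + 2\<close>.\<close>

lemma inner_falses:
  "fps_X ^ 2 * diag_sum (\<lambda>l. Abs_fps (\<lambda>N. (- 1) ^ N * \<alpha> (u @ F (l + 1) @ T (N + 1)))) =
     G * Abs_fps (\<lambda>j. \<alpha> (u @ F j)) - Abs_fps (\<lambda>K. of_nat (K - 1) * (- 1) ^ K * \<alpha> (u @ T K))"
  (is "_ * diag_sum ?f = _")
proof (rule fps_ext)
  fix K :: nat
  define d where "d i = \<alpha> (u @ F (K - i)) * b i" for i
  have d: "(\<Sum>i\<le>N. d i) = (- 1) ^ N * \<alpha> (u @ F (K - N) @ T N)" if "N \<le> K" for N
    unfolding d_def by (rule partial_convolution[OF that])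
  have G: "(G * Abs_fps (\<lambda>j. \<alpha> (u @ F j))) $ K = (\<Sum>i\<le>K. of_nat (i - 1) * d i)"
    unfolding fps_mult_nth by (simp add: G_def d_def atLeast0AtMost mult_ac)
  show "(fps_X ^ 2 * diag_sum ?f) $ K = (G * Abs_fps (\<lambda>j. \<alpha> (u @ F j)) -
      Abs_fps (\<lambda>K. of_nat (K - 1) * (- 1) ^ K * \<alpha> (u @ T K))) $ K"
  proof (cases "K < 2")
    case True
    then have "K = 0 \<or> K = 1" by auto
    then show ?thesis
      using G by (auto simp: fps_X_power_mult_nth)
  next
    case False
    then obtain s where K: "K = s + 2"
      by (metis add.commute le_Suc_ex not_less)
    \<comment> \<open>The term \<open>d i\<close> occurs in \<open>m + 1 - (i - 1)\<close> of the
      partial sums; truncated subtraction makes this correct at \<open>i = 0\<close> too.\<close>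
    have abel: "(\<Sum>N\<le>m. \<Sum>i\<le>N + 1. d i) =
        of_nat (m + 1) * (\<Sum>i\<le>m + 2. d i) - (\<Sum>i\<le>m + 2. of_nat (i - 1) * d i)" for m
      by (induction m) (simp_all add: algebra_simps numeral_2_eq_2)
    have "(fps_X ^ 2 * diag_sum ?f) $ K =
        (\<Sum>l\<le>s. (- 1) ^ (s - l) * \<alpha> (u @ F (l + 1) @ T (s - l + 1)))"
      by (simp add: fps_X_power_mult_nth K diag_sum_nth)
    also have "\<dots> = (\<Sum>N\<le>s. (- 1) ^ N * \<alpha> (u @ F (s - N + 1) @ T (N + 1)))"
      by (rule sum.reindex_bij_witness[where i = "\<lambda>i. s - i" and j = "\<lambda>i. s - i"]) auto
    \<comment> \<open>The minus sign appears because the partial sum up to \<open>N + 1\<close>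
      carries the sign \<open>(- 1) ^ (N + 1)\<close>.\<close>
    also have "\<dots> = (\<Sum>N\<le>s. - (\<Sum>i\<le>N + 1. d i))"
    proof (rule sum.cong)
      fix N assume "N \<in> {..s}"
      then have "N + 1 \<le> K" "K - (N + 1) = s - N + 1" using K by auto
      then show "(- 1) ^ N * \<alpha> (u @ F (s - N + 1) @ T (N + 1)) = - (\<Sum>i\<le>N + 1. d i)"
        using d[of "N + 1"] by (simp del: sum.atMost_Suc)
    qed simp
    also have "\<dots> = - (\<Sum>N\<le>s. \<Sum>i\<le>N + 1. d i)"
      by (rule sum_negf)
    also have "\<dots> = (\<Sum>i\<le>K. of_nat (i - 1) * d i) - of_nat (K - 1) * (\<Sum>i\<le>K. d i)"
      by (subst abel) (simp add: K)
    finally show ?thesis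
      using G d[of K] by (simp add: mult.assoc)
  qed
qed

text \<open>Clearing the left run leaves \<open>T (M + N + 1)\<close>, which belongs to
  \<open>b (M + N + 2)\<close>; hence the shift by two. The weight \<open>c\<close> is arbitrary
  because it is needed both for the constant 1, giving \<open>G\<close>, and for
  \<open>N - 1\<close>, giving a binomial coefficient.\<close>

lemma one_true_gf:
  "fps_X ^ 2 * (diag_sum (\<lambda>i. Abs_fps (\<lambda>N. c N * ((- 1) ^ N * \<alpha> ((F i @ [True]) @ T N)))) * P) =
     Abs_fps (\<lambda>n. (\<Sum>i<n - 1. c i) * b n)"
proof -
  have "diag_sum (\<lambda>i. Abs_fps (\<lambda>N. c N * ((- 1) ^ N * \<alpha> ((F i @ [True]) @ T N)))) =
      diag_sum (\<lambda>N. fps_const (c N * (- 1) ^ N) * Abs_fps (\<lambda>i. \<alpha> (F i @ [True] @ T N)))"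
    by (subst diag_sum_swap) (simp add: fps_const_mult_left mult.assoc)
  also have "\<dots> * P = diag_sum (\<lambda>N. fps_const (c N * (- 1) ^ N) *
      Abs_fps (\<lambda>M. (- 1) ^ M * \<alpha> (T M @ [True] @ T N)))"
    using left_falses[of "[True] @ T _"] by (simp flip: diag_sum_mult add: mult.assoc)
  also have "fps_X ^ 2 * \<dots> = Abs_fps (\<lambda>n. (\<Sum>i<n - 1. c i) * b n)"
  proof (rule fps_ext)
    fix n
    have *: "T M @ [True] @ T N = T (M + N + 1)" for M N
      by (rule replicate_eqI) auto
    show "(fps_X ^ 2 * diag_sum (\<lambda>N. fps_const (c N * (- 1) ^ N) *
        Abs_fps (\<lambda>M. (- 1) ^ M * \<alpha> (T M @ [True] @ T N)))) $ n =
        Abs_fps (\<lambda>n. (\<Sum>i<n - 1. c i) * b n) $ n"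
    proof (cases "n < 2")
      case True
      then show ?thesis by (auto simp: fps_X_power_mult_nth less_2_cases_iff)
    next
      case False
      then obtain s where n: "n = s + 2"
        by (metis add.commute le_Suc_ex not_less)
      have "(\<Sum>i\<le>s. c i * (- 1) ^ i * ((- 1) ^ (s - i) * \<alpha> (T (s - i) @ [True] @ T i))) =
          (\<Sum>i\<le>s. c i * ((- 1) ^ s * \<alpha> (T (s + 1))))"
        unfolding * by (rule sum.cong) (auto simp: mult.assoc simp flip: power_add mult.assoc[of "(-1) ^ _"])
      then show ?thesis
        by (simp add: fps_X_power_mult_nth n diag_sum_nth b_def lessThan_Suc_atMost
            sum_distrib_right mult.assoc)
    qed
  qed
  finally show ?thesis .
qed

text \<open>The first \<open>P\<close> clears the last run. Then \<open>inner_falses\<close> trades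
  the inner run for \<open>G\<close> times a series with a single final run, minus a boundary term
  \<open>A i\<close>. The second \<open>P\<close> clears that final run and the third the left
  run.\<close>

lemma separated_pair_gf:
  "fps_X ^ 4 * diag_sum (\<lambda>i. diag_sum (\<lambda>l.
       Abs_fps (\<lambda>j. \<alpha> (F i @ [True] @ F (l + 1) @ [True] @ F j)))) * P ^ 3 =
     G ^ 2 - P * Abs_fps (\<lambda>n. of_nat ((n - 2) choose 2) * b n)"
  (is "_ * ?V * _ = _ - P * ?K")
proof -
  \<comment> \<open>The factor \<open>1\<close> in \<open>Q\<close> makes both series literal
    instances of the one in \<open>one_true_gf\<close>.\<close>
  define A Q where "A i = Abs_fps (\<lambda>K. of_nat (K - 1) * ((- 1) ^ K * \<alpha> ((F i @ [True]) @ T K)))"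
    and "Q i = Abs_fps (\<lambda>N. 1 * ((- 1) ^ N * \<alpha> ((F i @ [True]) @ T N)))" for i
  have *: "Abs_fps (\<lambda>j. \<alpha> (F i @ [True] @ F (l + 1) @ [True] @ F j)) * P =
      Abs_fps (\<lambda>N. (- 1) ^ N * \<alpha> ((F i @ [True]) @ F (l + 1) @ T (N + 1)))" for i l
    using right_falses[of "F i @ [True] @ F (l + 1) @ [True]"] by simp
  have inner: "fps_X ^ 2 * diag_sum (\<lambda>l. Abs_fps (\<lambda>j.
      \<alpha> (F i @ [True] @ F (l + 1) @ [True] @ F j))) * P * P = Q i * G - A i * P" for i
  proof -
    have "fps_X ^ 2 * diag_sum (\<lambda>l. Abs_fps (\<lambda>j.
        \<alpha> (F i @ [True] @ F (l + 1) @ [True] @ F j))) * P =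
        G * Abs_fps (\<lambda>j. \<alpha> ((F i @ [True]) @ F j)) - A i"
      unfolding mult.assoc diag_sum_mult[symmetric] * inner_falses A_def by (simp add: mult.assoc)
    moreover have "G * Abs_fps (\<lambda>j. \<alpha> ((F i @ [True]) @ F j)) * P = Q i * G"
      unfolding Q_def mult.assoc right_falses by (simp add: mult.commute)
    ultimately show ?thesis by (simp only: left_diff_distrib)
  qed
  have "fps_X ^ 2 * ?V * P * P = ?V * (fps_X ^ 2 * P * P)"
    by (simp add: mult_ac)
  also have "\<dots> = diag_sum (\<lambda>i. Q i * G - A i * P)"
  proof -
    have "diag_sum (\<lambda>l. Abs_fps (\<lambda>j. \<alpha> (F i @ [True] @ F (l + 1) @ [True] @ F j))) *
        (fps_X ^ 2 * P * P) = Q i * G - A i * P" for i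
      using inner[of i] by (simp add: mult_ac)
    then show ?thesis
      by (simp only: diag_sum_mult[symmetric, of "\<lambda>i. diag_sum (_ i)"])
  qed
  also have "\<dots> = diag_sum Q * G - diag_sum A * P"
    by (simp add: diag_sum_diff diag_sum_mult)
  finally have V: "fps_X ^ 2 * ?V * P * P = diag_sum Q * G - diag_sum A * P" .
  have QG: "fps_X ^ 2 * (diag_sum Q * P) = G"
    unfolding Q_def one_true_gf G_def by simp
  have AK: "fps_X ^ 2 * (diag_sum A * P) = ?K"
    unfolding A_def one_true_gf sum_of_nat_pred by (simp add: numeral_2_eq_2)
  have "fps_X ^ 4 * ?V * P ^ 3 = fps_X ^ 2 * (fps_X ^ 2 * ?V * P * P) * P"
    by (simp add: eval_nat_numeral mult_ac)
  also have "\<dots> = (fps_X ^ 2 * (diag_sum Q * P)) * G - P * (fps_X ^ 2 * (diag_sum A * P))"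
    unfolding V by (simp add: algebra_simps)
  finally show ?thesis
    unfolding QG AK by (simp add: power2_eq_square)
qed

end

subsection \<open>Weights of labelled arrangements\<close>

definition rise :: "nat \<times> nat \<Rightarrow> nat \<times> nat \<Rightarrow> bool" where
  "rise x y \<longleftrightarrow> fst x < fst y \<and> snd x \<le> snd y"

fun rises :: "(nat \<times> nat) list \<Rightarrow> bool list" where
  "rises (x # y # zs) = rise x y # rises (y # zs)"
| "rises _ = []"

lemma length_rises [simp]: "length (rises zs) = length zs - 1"
  by (induction zs rule: rises.induct) auto

lemma rises_append:
  assumes "xs \<noteq> []" "ys \<noteq> []"
  shows "rises (xs @ ys) = rises xs @ rise (last xs) (hd ys) # rises ys"
  using assms
proof (induction xs rule: rises.induct)
  case ("2_2" x)
  then show ?case by (cases ys) auto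
qed auto

lemma rises_nth: "i + 1 < length zs \<Longrightarrow> rises zs ! i = rise (zs ! i) (zs ! (i + 1))"
  by (induction zs arbitrary: i rule: rises.induct) (auto simp: nth_Cons split: nat.splits)

text \<open>Since \<open>rise\<close> is transitive, rises between neighbours extend to all pairs of
  positions.\<close>

lemma rises_eq_trues_iff:
  "rises zs = replicate (length zs - 1) True \<longleftrightarrow> sorted_wrt rise zs"
proof -
  have "rises zs = replicate (length zs - 1) True \<longleftrightarrow> successively rise zs"
    by (induction zs rule: rises.induct) auto
  also have "\<dots> \<longleftrightarrow> sorted_wrt rise zs"
    by (rule successively_conv_sorted_wrt) (auto simp: transp_def rise_def)
  finally show ?thesis .
qed

text \<open>An arbitrary set \<open>C\<close> of values is allowed so that both pieces of a cut
  arrangement are of the same kind before standardisation.\<close>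

definition labelled :: "nat \<Rightarrow> nat set \<Rightarrow> (nat \<times> nat) list set" where
  "labelled k C = {zs. distinct (map fst zs) \<and> fst ` set zs = C \<and> snd ` set zs \<subseteq> {..<k}}"

lemma labelled_length: "zs \<in> labelled k C \<Longrightarrow> length zs = card C"
  unfolding labelled_def using distinct_card by fastforce

lemma finite_labelled: "finite C \<Longrightarrow> finite (labelled k C)"
proof (rule finite_subset)
  show "labelled k C \<subseteq> {zs. set zs \<subseteq> C \<times> {..<k} \<and> length zs = card C}"
  proof
    fix zs assume zs: "zs \<in> labelled k C"
    then have "set zs \<subseteq> C \<times> {..<k}"
      by (force simp: labelled_def)
    then show "zs \<in> {zs. set zs \<subseteq> C \<times> {..<k} \<and> length zs = card C}"
      using labelled_length[OF zs] by simp
  qed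
  show "finite C \<Longrightarrow> finite {zs. set zs \<subseteq> C \<times> {..<k} \<and> length zs = card C}"
    by (rule finite_lists_length_eq) simp
qed

lemma finite_labelled_Collect [simp]: "finite C \<Longrightarrow> finite {zs \<in> labelled k C. Q zs}"
  using finite_labelled by simp

lemma labelled_map:
  assumes "inj_on g C" "zs \<in> labelled k C"
  shows "map (map_prod g id) zs \<in> labelled k (g ` C)"
proof -
  have "distinct (map g (map fst zs))"
    using assms by (subst distinct_map) (auto simp: labelled_def)
  moreover have "map fst (map (map_prod g id) zs) = map g (map fst zs)"
    "map snd (map (map_prod g id) zs) = map snd zs"
    by simp_all
  moreover have "set (map fst zs) = C" "set (map snd zs) \<subseteq> {..<k}"
    using assms by (simp_all add: labelled_def)
  ultimately show ?thesis
    unfolding labelled_def mem_Collect_eq set_map[symmetric]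
    by (metis set_map)
qed

section \<open>Weights, standardisation and cutting\<close>

context
  fixes p q :: "'a::field"
begin

definition pair_weight :: "nat \<Rightarrow> nat \<Rightarrow> 'a" where
  "pair_weight x y = (if x < y then p else q)"

definition cross_weight :: "nat set \<Rightarrow> nat set \<Rightarrow> 'a" where
  "cross_weight D E = (\<Prod>x\<in>D. \<Prod>y\<in>E. pair_weight x y)"

text \<open>Each pair of positions contributes \<open>p\<close> if it is a coinversion and
  \<open>q\<close> if it is an inversion. The product over a set of values sees every later position
  once because the values are distinct in all uses.\<close>

fun weight :: "'a \<Rightarrow> (nat \<times> nat) list \<Rightarrow> 'a" where
  "weight r [] = 1"
| "weight r (z # zs) = r ^ snd z * (\<Prod>y\<in>fst ` set zs. pair_weight (fst z) y) * weight r zs"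

text \<open>Pairs across the cut contribute through the two value sets alone, so the weights of the
  two pieces separate once these sets are fixed.\<close>

lemma weight_append:
  assumes "distinct (map fst (xs @ ys))"
  shows "weight r (xs @ ys) = weight r xs * weight r ys * cross_weight (fst ` set xs) (fst ` set ys)"
  using assms
proof (induction xs)
  case Nil
  show ?case by (simp add: cross_weight_def)
next
  case (Cons x xs)
  have "(\<Prod>y\<in>fst ` set xs \<union> fst ` set ys. pair_weight (fst x) y) =
      (\<Prod>y\<in>fst ` set xs. pair_weight (fst x) y) * (\<Prod>y\<in>fst ` set ys. pair_weight (fst x) y)"
    by (rule prod.union_disjoint) (use Cons.prems in auto)
  moreover have "cross_weight (insert (fst x) (fst ` set xs)) E =
      (\<Prod>y\<in>E. pair_weight (fst x) y) * cross_weight (fst ` set xs) E" for E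
    unfolding cross_weight_def by (rule prod.insert) (use Cons.prems in auto)
  ultimately show ?case
    using Cons by (simp add: image_Un mult_ac)
qed

lemma weight_map:
  assumes "strict_mono_on D h" "fst ` set zs \<subseteq> D" "distinct (map fst zs)"
  shows "weight r (map (map_prod h id) zs) = weight r zs"
  using assms(2,3)
proof (induction zs)
  case (Cons z zs)
  have inj: "inj_on h D"
    using assms(1) by (rule strict_mono_on_imp_inj_on)
  have "(\<Prod>y\<in>h ` fst ` set zs. pair_weight (h (fst z)) y) =
      (\<Prod>y\<in>fst ` set zs. pair_weight (h (fst z)) (h y))"
    by (rule prod.reindex_cong[of h])
      (use Cons.prems in \<open>auto intro: inj_on_subset[OF inj]\<close>)
  also have "\<dots> = (\<Prod>y\<in>fst ` set zs. pair_weight (fst z) y)"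
    by (rule prod.cong)
      (use Cons.prems in \<open>auto simp: pair_weight_def strict_mono_on_less[OF assms(1)]\<close>)
  finally show ?case
    using Cons by (simp add: image_image map_prod_def case_prod_unfold)
qed simp

lemma weight_sorted:
  "sorted_wrt (<) (map fst zs) \<Longrightarrow>
     weight r zs = p ^ (length zs choose 2) * r ^ sum_list (map snd zs)"
proof (induction zs)
  case (Cons z zs)
  have "distinct (map fst zs)"
    using Cons.prems by (auto simp: strict_sorted_iff)
  then have card: "card (fst ` set zs) = length zs"
    using distinct_card by fastforce
  have "(\<Prod>y\<in>fst ` set zs. pair_weight (fst z) y) = (\<Prod>y\<in>fst ` set zs. p)"
    by (rule prod.cong) (use Cons.prems in \<open>auto simp: pair_weight_def\<close>)
  also have "\<dots> = p ^ length zs"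
    by (simp add: card)
  finally show ?case
    using Cons by (simp add: power_add numeral_2_eq_2 mult_ac)
qed (simp add: numeral_2_eq_2)

text \<open>A predicate on rise words covers both a prescribed word and the trivial condition used
  to identify the factorials.\<close>

definition total :: "'a \<Rightarrow> nat \<Rightarrow> nat set \<Rightarrow> (bool list \<Rightarrow> bool) \<Rightarrow> 'a" where
  "total r k C Q = (\<Sum>zs | zs \<in> labelled k C \<and> Q (rises zs). weight r zs)"

text \<open>Standardisation: weight and rise word depend only on the relative order of the values
  and on the colours, which strictly increasing relabelling preserves.\<close>

lemma total_image:
  assumes h: "strict_mono_on D h"
  shows "total r k (h ` D) Q = total r k D Q"
proof -
  have inj: "inj_on h D"
    using h by (rule strict_mono_on_imp_inj_on)
  have rises: "rises (map (map_prod h id) zs) = rises zs" if "fst ` set zs \<subseteq> D" for zs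
    using that
    by (induction zs rule: rises.induct) (auto simp: rise_def strict_mono_on_less[OF h])
  have inv: "map (map_prod (inv_into D h) id) (map (map_prod h id) zs) = zs"
    if "fst ` set zs \<subseteq> D" for zs
    using that inj by (auto simp: map_prod_def case_prod_unfold intro!: map_idI)
  have inv': "map (map_prod h id) (map (map_prod (inv_into D h) id) zs) = zs"
    if "fst ` set zs \<subseteq> h ` D" for zs
    using that by (auto simp: map_prod_def case_prod_unfold f_inv_into_f image_subset_iff intro!: map_idI)
  have map_in: "map (map_prod h id) zs \<in> labelled k (h ` D)" if "zs \<in> labelled k D" for zs
    using that inj by (rule labelled_map[rotated])
  have map_inv_in: "map (map_prod (inv_into D h) id) zs \<in> labelled k D"
    if "zs \<in> labelled k (h ` D)" for zs
  proof -
    have "inv_into D h ` h ` D = D" "inj_on (inv_into D h) (h ` D)"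
      using inj by (auto simp: inj_on_inv_into)
    then show ?thesis
      using labelled_map[OF _ that] by metis
  qed
  have sub: "zs \<in> labelled k C \<Longrightarrow> fst ` set zs \<subseteq> C" for zs C
    by (simp add: labelled_def)
  have "(\<Sum>zs | zs \<in> labelled k D \<and> Q (rises zs). weight r zs) =
      (\<Sum>zs | zs \<in> labelled k (h ` D) \<and> Q (rises zs). weight r zs)"
  proof (rule sum.reindex_bij_witness[where j = "map (map_prod h id)"
        and i = "map (map_prod (inv_into D h) id)"])
    fix zs assume "zs \<in> {zs. zs \<in> labelled k D \<and> Q (rises zs)}"
    then have zs: "zs \<in> labelled k D" "Q (rises zs)" by simp_all
    note sub = sub[OF zs(1)]
    show "map (map_prod (inv_into D h) id) (map (map_prod h id) zs) = zs"
      by (rule inv[OF sub])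
    show "map (map_prod h id) zs \<in> {zs. zs \<in> labelled k (h ` D) \<and> Q (rises zs)}"
      using map_in[OF zs(1)] zs(2) rises[OF sub] by simp
    show "weight r (map (map_prod h id) zs) = weight r zs"
      by (rule weight_map[OF h sub]) (use zs in \<open>simp add: labelled_def\<close>)
  next
    fix zs assume "zs \<in> {zs. zs \<in> labelled k (h ` D) \<and> Q (rises zs)}"
    then have zs: "zs \<in> labelled k (h ` D)" "Q (rises zs)" by simp_all
    show inv'': "map (map_prod h id) (map (map_prod (inv_into D h) id) zs) = zs"
      by (rule inv'[OF sub[OF zs(1)]])
    have in_D: "map (map_prod (inv_into D h) id) zs \<in> labelled k D"
      by (rule map_inv_in[OF zs(1)])
    have "rises (map (map_prod (inv_into D h) id) zs) = rises zs"
      using rises[OF sub[OF in_D]] unfolding inv'' by simp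
    then show "map (map_prod (inv_into D h) id) zs \<in> {zs. zs \<in> labelled k D \<and> Q (rises zs)}"
      using in_D zs(2) by simp
  qed
  then show ?thesis
    by (simp add: total_def)
qed

lemma total_card:
  assumes "finite C"
  shows "total r k C Q = total r k {1..card C} Q"
proof -
  have "total r k D Q = total r k {..<card D} Q" if fin: "finite D" for D
  proof -
    obtain h where "bij_betw h {..<card D} D" "strict_mono_on {..<card D} h"
      using ex_bij_betw_strict_mono_card[OF fin] by metis
    then show ?thesis
      using total_image by (metis bij_betw_imp_surj_on)
  qed
  from this[OF assms] this[of "{1..card C}"] show ?thesis by simp
qed

text \<open>An arrangement corresponds to the set \<open>D\<close> of its first \<open>m\<close>
  values together with arrangements of \<open>D\<close> and of \<open>C - D\<close>.\<close>

lemma sum_split: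
  assumes C: "finite C" "card C = m + l"
  shows "(\<Sum>zs | zs \<in> labelled k C \<and> Q (rises (take m zs)) \<and> R (rises (drop m zs)). weight r zs) =
    (\<Sum>D | D \<subseteq> C \<and> card D = m. cross_weight D (C - D) * (total r k D Q * total r k (C - D) R))"
proof -
  let ?A = "\<lambda>D Q. {zs. zs \<in> labelled k D \<and> Q (rises zs)}"
  have fin: "finite D" if "D \<subseteq> C" for D
    using C(1) that finite_subset by blast
  have "(\<Sum>D | D \<subseteq> C \<and> card D = m. cross_weight D (C - D) * (total r k D Q * total r k (C - D) R)) =
      (\<Sum>D | D \<subseteq> C \<and> card D = m. \<Sum>(xs, ys)\<in>?A D Q \<times> ?A (C - D) R.
        cross_weight D (C - D) * (weight r xs * weight r ys))"
    unfolding total_def sum_product sum.cartesian_product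
    by (simp add: sum_distrib_left case_prod_unfold)
  also have "\<dots> = (\<Sum>(D, xs, ys)\<in>(SIGMA D:{D. D \<subseteq> C \<and> card D = m}. ?A D Q \<times> ?A (C - D) R).
      cross_weight D (C - D) * (weight r xs * weight r ys))"
    by (subst sum.Sigma) (auto simp: C fin case_prod_unfold)
  also have "\<dots> = (\<Sum>zs | zs \<in> labelled k C \<and> Q (rises (take m zs)) \<and> R (rises (drop m zs)). weight r zs)"
  proof (rule sum.reindex_bij_witness[where
        i = "\<lambda>zs. (fst ` set (take m zs), take m zs, drop m zs)" and j = "\<lambda>(D, xs, ys). xs @ ys"])
    fix x assume "x \<in> (SIGMA D:{D. D \<subseteq> C \<and> card D = m}. ?A D Q \<times> ?A (C - D) R)"
    then obtain D xs ys where x: "x = (D, xs, ys)" and D: "D \<subseteq> C" "card D = m"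
      and xs: "xs \<in> labelled k D" "Q (rises xs)" and ys: "ys \<in> labelled k (C - D)" "R (rises ys)"
      by auto
    have len: "length xs = m"
      using xs labelled_length D by simp
    have sets: "fst ` set xs = D" "fst ` set ys = C - D"
      using xs ys by (auto simp: labelled_def)
    have dist: "distinct (map fst (xs @ ys))"
      using xs ys by (auto simp: labelled_def)
    show "(\<lambda>zs. (fst ` set (take m zs), take m zs, drop m zs)) (case x of (D, xs, ys) \<Rightarrow> xs @ ys) = x"
      using len sets by (simp add: x)
    have "xs @ ys \<in> labelled k C"
      using xs ys dist D by (auto simp: labelled_def image_Un)
    then show "(case x of (D, xs, ys) \<Rightarrow> xs @ ys) \<in>
        {zs \<in> labelled k C. Q (rises (take m zs)) \<and> R (rises (drop m zs))}"
      using len xs ys by (simp add: x)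
    show "weight r (case x of (D, xs, ys) \<Rightarrow> xs @ ys) =
        (case x of (D, xs, ys) \<Rightarrow> cross_weight D (C - D) * (weight r xs * weight r ys))"
      using weight_append[OF dist] sets by (simp add: x mult_ac)
  next
    fix zs assume zs: "zs \<in> {zs \<in> labelled k C. Q (rises (take m zs)) \<and> R (rises (drop m zs))}"
    obtain xs ys where eq: "zs = xs @ ys" "take m zs = xs" "drop m zs = ys"
      by (metis append_take_drop_id)
    have dist: "distinct (map fst xs)" "distinct (map fst ys)" "fst ` set xs \<inter> fst ` set ys = {}"
      and C_eq: "fst ` set xs \<union> fst ` set ys = C"
      and snd: "snd ` set xs \<subseteq> {..<k}" "snd ` set ys \<subseteq> {..<k}"
      using zs by (simp_all add: labelled_def eq(1) image_Un)
    have QR: "Q (rises xs)" "R (rises ys)"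
      using zs unfolding eq(2,3)[symmetric] by simp_all
    have "length zs = m + l"
      using zs labelled_length[of zs k C] C by simp
    then have "length xs = m"
      using eq(2) by auto
    then have "card (fst ` set xs) = m"
      using dist(1) distinct_card[of "map fst xs"] by simp
    moreover have "fst ` set ys = C - fst ` set xs" "fst ` set xs \<subseteq> C"
      using dist(3) C_eq by blast+
    ultimately show "(fst ` set (take m zs), take m zs, drop m zs) \<in>
        (SIGMA D:{D. D \<subseteq> C \<and> card D = m}. ?A D Q \<times> ?A (C - D) R)"
      using dist snd QR unfolding eq(2,3) by (simp add: labelled_def)
  qed simp
  finally show ?thesis by simp
qed

text \<open>The \<open>p,q\<close>-binomial coefficient in its subset form.\<close>

definition gauss_sum :: "nat \<Rightarrow> nat \<Rightarrow> 'a" where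
  "gauss_sum n m = (\<Sum>D | D \<subseteq> {1..n} \<and> card D = m. cross_weight D ({1..n} - D))"

lemma sum_split_gauss:
  "(\<Sum>zs | zs \<in> labelled k {1..m + l} \<and> Q (rises (take m zs)) \<and> R (rises (drop m zs)). weight r zs) =
     gauss_sum (m + l) m * (total r k {1..m} Q * total r k {1..l} R)"
proof -
  have "total r k D Q = total r k {1..m} Q \<and> total r k ({1..m + l} - D) R = total r k {1..l} R"
    if "D \<subseteq> {1..m + l}" "card D = m" for D
  proof -
    have "finite D" using that finite_subset by blast
    then show ?thesis
      using that total_card[of D] total_card[of "{1..m + l} - D"] by (simp add: card_Diff_subset)
  qed
  then have "(\<Sum>D | D \<subseteq> {1..m + l} \<and> card D = m. cross_weight D ({1..m + l} - D) *
        (total r k D Q * total r k ({1..m + l} - D) R)) =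
      (\<Sum>D | D \<subseteq> {1..m + l} \<and> card D = m. cross_weight D ({1..m + l} - D) *
        (total r k {1..m} Q * total r k {1..l} R))"
    by (intro sum.cong refl) (metis (mono_tags, lifting) mem_Collect_eq)
  then show ?thesis
    using sum_split[where C = "{1..m + l}" and m = m and l = l and k = k and Q = Q and R = R and r = r] unfolding gauss_sum_def sum_distrib_right by simp
qed

text \<open>A first value \<open>Suc i\<close> is followed by \<open>i\<close> smaller values, each
  giving \<open>q\<close>, and \<open>n - i\<close> larger ones, each giving
  \<open>p\<close>.\<close>

lemma gauss_sum_1: "gauss_sum (Suc n) 1 = pq_num p q (Suc n)"
proof -
  have cw: "cross_weight {Suc i} ({1..Suc n} - {Suc i}) = p ^ (n - i) * q ^ i" if "i < Suc n" for i
  proof -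
    have split: "{1..Suc n} - {Suc i} = {1..i} \<union> {Suc (Suc i)..Suc n}"
      using that by auto
    have "cross_weight {Suc i} ({1..Suc n} - {Suc i}) =
        (\<Prod>y\<in>{1..i}. pair_weight (Suc i) y) * (\<Prod>y\<in>{Suc (Suc i)..Suc n}. pair_weight (Suc i) y)"
      unfolding split cross_weight_def by (subst prod.union_disjoint) auto
    also have "(\<Prod>y\<in>{1..i}. pair_weight (Suc i) y) = (\<Prod>y\<in>{1..i}. q)"
      by (rule prod.cong) (auto simp: pair_weight_def)
    also have "(\<Prod>y\<in>{Suc (Suc i)..Suc n}. pair_weight (Suc i) y) = (\<Prod>y\<in>{Suc (Suc i)..Suc n}. p)"
      by (rule prod.cong) (auto simp: pair_weight_def)
    finally show ?thesis by (simp add: mult.commute)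
  qed
  have "gauss_sum (Suc n) 1 = (\<Sum>i<Suc n. cross_weight {Suc i} ({1..Suc n} - {Suc i}))"
    unfolding gauss_sum_def
  proof (rule sum.reindex_cong[of "\<lambda>i. {Suc i}"])
    show "inj_on (\<lambda>i. {Suc i}) {..<Suc n}" by (auto simp: inj_on_def)
    have "\<exists>i\<in>{..<Suc n}. x = Suc i" if "1 \<le> x" "x \<le> Suc n" for x
      using that by (intro bexI[of _ "x - 1"]) auto
    then show "{D. D \<subseteq> {1..Suc n} \<and> card D = 1} = (\<lambda>i. {Suc i}) ` {..<Suc n}"
      by (auto simp: card_1_singleton_iff image_iff)
  qed simp
  also have "\<dots> = (\<Sum>i<Suc n. p ^ (n - i) * q ^ i)"
    by (rule sum.cong) (use cw in auto)
  finally show ?thesis by (simp add: pq_num_def)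
qed

text \<open>With \<open>k = 1\<close> all colours are 0, so this is the distribution of
  \<open>inv\<close> and \<open>coinv\<close> over permutations. Cutting off the first letter gives
  the recursion of the factorial.\<close>

lemma total_all: "total r 1 {1..n} (\<lambda>_. True) = pq_fact p q n"
proof (induction n)
  case 0
  have "labelled 1 {} = {[]}" by (auto simp: labelled_def)
  then show ?case by (simp add: total_def pq_fact_def)
next
  case (Suc n)
  have "labelled 1 {Suc 0} = {[(Suc 0, 0)]}"
  proof -
    have "zs = [(Suc 0, 0)]" if zs: "zs \<in> labelled 1 {Suc 0}" for zs
    proof -
      have "length zs = 1" using labelled_length[OF zs] by simp
      then obtain z where "zs = [z]" by (auto simp: length_Suc_conv)
      then show ?thesis using zs by (cases z) (auto simp: labelled_def)
    qed
    then show ?thesis by (auto simp: labelled_def)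
  qed
  then have "total r 1 {1..1} (\<lambda>_. True) = 1"
    by (simp add: total_def)
  moreover have "total r 1 {1..Suc n} (\<lambda>_. True) =
      gauss_sum (Suc n) 1 * (total r 1 {1..1} (\<lambda>_. True) * total r 1 {1..n} (\<lambda>_. True))"
    using sum_split_gauss[where m = 1 and l = n and k = 1 and Q = "\<lambda>_. True" and R = "\<lambda>_. True"]
    by (simp add: total_def)
  ultimately show ?case
    using Suc by (simp add: gauss_sum_1[simplified] pq_fact_def mult.commute)
qed

text \<open>Cutting all uncoloured arrangements after position \<open>m\<close> gives the quotient
  formula directly, without a Pascal recursion.\<close>

lemma gauss_sum_pq_fact:
  "gauss_sum (m + l) m * (pq_fact p q m * pq_fact p q l) = pq_fact p q (m + l)"
  using sum_split_gauss[where m = m and l = l and k = 1 and Q = "\<lambda>_. True" and R = "\<lambda>_. True" and r = 1]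
  by (simp add: total_all[simplified] flip: total_def[where Q = "\<lambda>_. True", simplified])

text \<open>This is the function \<open>\<alpha>\<close> to which the locale \<open>ribbon\<close>
  is applied.\<close>

definition pattern_sum :: "'a \<Rightarrow> nat \<Rightarrow> bool list \<Rightarrow> 'a" where
  "pattern_sum r k u =
     total r k {1..length u + 1} (\<lambda>v. v = u) / pq_fact p q (length u + 1)"

text \<open>Prescribing the rise words of both pieces leaves only the letter at the cut open, which
  is \<open>False\<close> or \<open>True\<close>.\<close>

lemma pattern_sum_mult:
  assumes nz: "\<And>n. n \<ge> 1 \<Longrightarrow> pq_num p q n \<noteq> 0"
  shows "pattern_sum r k u * pattern_sum r k v =
    pattern_sum r k (u @ False # v) + pattern_sum r k (u @ True # v)"
proof -
  define m l where "m = length u + 1" and "l = length v + 1"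
  have nzf: "pq_fact p q n \<noteq> 0" for n
    using nz by (simp add: pq_fact_def)
  let ?T = "\<lambda>w. {zs. zs \<in> labelled k {1..m + l} \<and> rises zs = w}"
  have "{zs. zs \<in> labelled k {1..m + l} \<and> rises (take m zs) = u \<and> rises (drop m zs) = v} =
      ?T (u @ False # v) \<union> ?T (u @ True # v)"
  proof -
    have "rises (take m zs) = u \<and> rises (drop m zs) = v \<longleftrightarrow>
        rises zs = u @ False # v \<or> rises zs = u @ True # v" if "zs \<in> labelled k {1..m + l}" for zs
    proof -
      have len: "length zs = m + l"
        using labelled_length[OF that] by simp
      have "take m zs \<noteq> []" "drop m zs \<noteq> []"
        using len by (auto simp: m_def l_def)
      from rises_append[OF this] have r: "rises zs = rises (take m zs) @
          rise (last (take m zs)) (hd (drop m zs)) # rises (drop m zs)" by simp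
      have "length (rises (take m zs)) = length u"
        using len by (simp add: m_def)
      then show ?thesis unfolding r by auto
    qed
    then show ?thesis by auto
  qed
  then have "gauss_sum (m + l) m * (total r k {1..m} (\<lambda>w. w = u) * total r k {1..l} (\<lambda>w. w = v)) =
      (\<Sum>zs\<in>?T (u @ False # v) \<union> ?T (u @ True # v). weight r zs)"
    using sum_split_gauss[where m = m and l = l and Q = "\<lambda>w. w = u" and R = "\<lambda>w. w = v"]
    by (metis (no_types, lifting))
  also have "\<dots> = total r k {1..m + l} (\<lambda>w. w = u @ False # v) + total r k {1..m + l} (\<lambda>w. w = u @ True # v)"
    unfolding total_def by (rule sum.union_disjoint) auto
  finally have "gauss_sum (m + l) m * (total r k {1..m} (\<lambda>w. w = u) * total r k {1..l} (\<lambda>w. w = v)) =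
      total r k {1..m + l} (\<lambda>w. w = u @ False # v) + total r k {1..m + l} (\<lambda>w. w = u @ True # v)" .
  moreover have "x / pq_fact p q m * (y / pq_fact p q l) =
      gauss_sum (m + l) m * (x * y) / pq_fact p q (m + l)" for x y
    using nzf[of m] nzf[of l] nzf[of "m + l"] gauss_sum_pq_fact[of m l]
    by (simp add: divide_eq_eq eq_divide_eq)
  moreover have "length (u @ c # v) + 1 = m + l" for c
    by (simp add: m_def l_def)
  ultimately show ?thesis
    unfolding pattern_sum_def m_def[symmetric] l_def[symmetric]
    by (simp add: add_divide_distrib)
qed

end

section \<open>Weakly increasing words and Gaussian binomial coefficients\<close>

definition sorted_words :: "nat \<Rightarrow> nat \<Rightarrow> nat list set" where
  "sorted_words m k = {ws. length ws = m \<and> sorted ws \<and> set ws \<subseteq> {..<k}}"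

lemma finite_sorted_words: "finite (sorted_words m k)"
  by (rule finite_subset[OF _ finite_lists_length_eq[of "{..<k}" m]]) (auto simp: sorted_words_def)

text \<open>A weakly increasing word either starts with 0 or has only positive letters, which can
  all be lowered by one.\<close>

lemma sorted_words_Suc:
  "sorted_words (Suc m) (Suc k) = (#) 0 ` sorted_words m (Suc k) \<union> map Suc ` sorted_words (Suc m) k"
proof (intro equalityI subsetI)
  fix ws assume ws: "ws \<in> sorted_words (Suc m) (Suc k)"
  then obtain x xs where x: "ws = x # xs" by (auto simp: sorted_words_def length_Suc_conv)
  show "ws \<in> (#) 0 ` sorted_words m (Suc k) \<union> map Suc ` sorted_words (Suc m) k"
  proof (cases "x = 0")
    case True
    then show ?thesis using ws x by (auto simp: sorted_words_def)
  next
    case False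
    then have "\<forall>y\<in>set ws. y > 0" using ws x by (auto simp: sorted_words_def)
    then have "map Suc (map (\<lambda>y. y - 1) ws) = ws"
      by (auto intro!: map_idI)
    moreover have "map (\<lambda>y. y - 1) ws \<in> sorted_words (Suc m) k"
      using ws \<open>\<forall>y\<in>set ws. y > 0\<close>
      by (fastforce simp: sorted_words_def sorted_map intro!: sorted_wrt_mono_rel[of ws "(\<le>)"])
    ultimately show ?thesis by (metis UnI2 imageI)
  qed
next
  fix ws assume "ws \<in> (#) 0 ` sorted_words m (Suc k) \<union> map Suc ` sorted_words (Suc m) k"
  then show "ws \<in> sorted_words (Suc m) (Suc k)"
    by (auto simp: sorted_words_def sorted_map)
qed

text \<open>The decomposition \<open>sorted_words_Suc\<close> matches the \<open>r\<close>-Pascal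
  rule: raising all \<open>m\<close> letters by one multiplies the weight by
  \<open>r ^ m\<close>.\<close>

lemma sum_sorted_words:
  fixes r :: "'a::field"
  assumes nz: "\<And>n. n \<ge> 1 \<Longrightarrow> q_num r n \<noteq> 0"
  shows "(\<Sum>ws\<in>sorted_words m (Suc k). r ^ sum_list ws) = q_binom r (m + k) m"
proof (induction "m + k" arbitrary: m k rule: less_induct)
  case less
  have nzf: "q_fact r n \<noteq> 0" for n
    using nz by (simp add: q_fact_def)
  consider "m = 0" | "k = 0" "m \<noteq> 0" | m' k' where "m = Suc m'" "k = Suc k'"
    by (metis not0_implies_Suc)
  then show ?case
  proof cases
    case 1
    then have "sorted_words m (Suc k) = {[]}" by (auto simp: sorted_words_def)
    then show ?thesis using 1 nzf by (simp add: q_binom_def q_fact_def)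
  next
    case 2
    have "sorted_words m (Suc 0) = {replicate m 0}"
      by (auto simp: sorted_words_def intro!: replicate_eqI)
    then show ?thesis using 2 nzf[of m] by (simp add: q_binom_def q_fact_def[of _ 0] sum_list_replicate)
  next
    case 3
    have "(\<Sum>ws\<in>sorted_words m (Suc k). r ^ sum_list ws) =
        (\<Sum>ws\<in>(#) 0 ` sorted_words m' (Suc k). r ^ sum_list ws) +
        (\<Sum>ws\<in>map Suc ` sorted_words m k. r ^ sum_list ws)"
      unfolding 3 sorted_words_Suc
      by (rule sum.union_disjoint) (auto simp: finite_sorted_words)
    also have "(\<Sum>ws\<in>(#) 0 ` sorted_words m' (Suc k). r ^ sum_list ws) = q_binom r (m' + k) m'"
      using less[of m' k] 3 by (subst sum.reindex) auto
    also have "(\<Sum>ws\<in>map Suc ` sorted_words m k. r ^ sum_list ws) =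
        (\<Sum>ws\<in>sorted_words m k. r ^ m * r ^ sum_list ws)"
    proof (subst sum.reindex)
      have "sum_list (map Suc ws) = length ws + sum_list ws" for ws
        by (induction ws) auto
      then show "sum ((\<lambda>ws. r ^ sum_list ws) \<circ> map Suc) (sorted_words m k) =
          (\<Sum>ws\<in>sorted_words m k. r ^ m * r ^ sum_list ws)"
        by (intro sum.cong) (auto simp: sorted_words_def power_add)
    qed (simp add: inj_on_def)
    also have "\<dots> = r ^ m * q_binom r (m + k') m"
      using less[of m k'] 3 by (simp flip: sum_distrib_left)
    also have "q_binom r (m' + k) m' + r ^ m * q_binom r (m + k') m = q_binom r (m + k) m"
    proof -
      \<comment> \<open>After cancelling the common factorials, the Pascal rule is exactly this
        splitting of \<open>q_num r (m + k)\<close>.\<close>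
      have "q_num r (a + b) = q_num r a + r ^ a * q_num r b" for a b
        by (induction b) (simp_all add: q_num_def algebra_simps power_add)
      then have num: "q_num r (m + k) = q_num r m + r ^ m * q_num r k" .
      have fact: "q_fact r (Suc n) = q_num r (Suc n) * q_fact r n" for n
        by (simp add: q_fact_def mult.commute)
      have "q_num r m \<noteq> 0" "q_num r k \<noteq> 0" using nz 3 by auto
      define N where "N = q_fact r (m' + k)"
      have *: "q_fact r (m + k) = (q_num r m + r ^ m * q_num r k) * N"
        "q_fact r (m + k') = N" "q_fact r m = q_num r m * q_fact r m'"
        "q_fact r k = q_num r k * q_fact r k'"
        using fact[of "m' + k"] num 3 fact by (simp_all add: N_def)
      show ?thesis
        unfolding q_binom_def diff_add_inverse * N_def[symmetric]
        using nzf \<open>q_num r m \<noteq> 0\<close> \<open>q_num r k \<noteq> 0\<close> by (simp add: field_simps)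
    qed
    finally show ?thesis .
  qed
qed

text \<open>If every position is a rise, the values are in increasing order and the colours form a
  weakly increasing word. All pairs are coinversions, so only the colours vary.\<close>

lemma pattern_sum_trues:
  fixes p q r :: "'a::field"
  assumes nz: "\<And>n. n \<ge> 1 \<Longrightarrow> q_num r n \<noteq> 0" and k: "k \<ge> 1"
  shows "pattern_sum p q r k (replicate m True) =
    p ^ (Suc m choose 2) * q_binom r (Suc m + k - 1) (Suc m) / pq_fact p q (Suc m)"
proof -
  let ?A = "{zs. zs \<in> labelled k {1..Suc m} \<and> rises zs = replicate m True}"
  have A: "sorted_wrt (<) (map fst zs)" "sorted (map snd zs)" "map fst zs = [1..<Suc (Suc m)]"
    if "zs \<in> ?A" for zs
  proof -
    have len: "length zs = Suc m"
      using that labelled_length by fastforce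
    have "sorted_wrt rise zs"
      using that len by (subst rises_eq_trues_iff[symmetric]) simp
    then show *: "sorted_wrt (<) (map fst zs)" and "sorted (map snd zs)"
      by (auto simp: sorted_wrt_map rise_def elim!: sorted_wrt_mono_rel[rotated])
    show "map fst zs = [1..<Suc (Suc m)]"
      by (rule sorted_distinct_set_unique)
        (use * that in \<open>auto simp: strict_sorted_iff labelled_def simp del: upt_Suc\<close>)
  qed
  have "total p q r k {1..Suc m} (\<lambda>w. w = replicate m True) =
      (\<Sum>zs\<in>?A. p ^ (Suc m choose 2) * r ^ sum_list (map snd zs))"
    unfolding total_def
  proof (rule sum.cong)
    fix zs assume zs: "zs \<in> ?A"
    then have "length zs = Suc m" using labelled_length[of zs k "{1..Suc m}"] by simp
    then show "weight p q r zs = p ^ (Suc m choose 2) * r ^ sum_list (map snd zs)"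
      using weight_sorted[OF A(1)[OF zs], of p q r] by simp
  qed simp
  also have "\<dots> = (\<Sum>ws\<in>sorted_words (Suc m) k. p ^ (Suc m choose 2) * r ^ sum_list ws)"
  proof (rule sum.reindex_bij_witness[where i = "zip [1..<Suc (Suc m)]" and j = "map snd"])
    fix zs assume zs: "zs \<in> ?A"
    show "zip [1..<Suc (Suc m)] (map snd zs) = zs"
      using A(3)[OF zs] by (metis zip_map_fst_snd)
    show "map snd zs \<in> sorted_words (Suc m) k"
      using A(2)[OF zs] zs labelled_length[of zs k "{1..Suc m}"]
      by (simp add: sorted_words_def labelled_def)
  next
    fix ws assume ws: "ws \<in> sorted_words (Suc m) k"
    then have len: "length ws = Suc m" by (simp add: sorted_words_def)
    let ?z = "zip [1..<Suc (Suc m)] ws"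
    have f: "map fst ?z = [1..<Suc (Suc m)]" "map snd ?z = ws"
      using len by (simp_all del: upt_Suc)
    show "map snd ?z = ws" by fact
    have "sorted_wrt rise ?z"
      using ws len by (auto simp: sorted_wrt_iff_nth_less rise_def sorted_words_def simp del: upt_Suc)
    then have "rises ?z = replicate m True"
      using len by (subst (asm) rises_eq_trues_iff[symmetric]) (simp del: upt_Suc)
    moreover have "?z \<in> labelled k {1..Suc m}"
    proof -
      have "fst ` set ?z = set [1..<Suc (Suc m)]" "snd ` set ?z = set ws"
        by (simp_all only: f flip: set_map)
      moreover have "set [1..<Suc (Suc m)] = {1..Suc m}"
        by auto
      moreover have "distinct (map fst ?z)"
        unfolding f by simp
      ultimately show ?thesis
        using ws by (simp add: labelled_def sorted_words_def del: upt_Suc)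
    qed
    ultimately show "?z \<in> ?A" by simp
  qed simp
  also have "\<dots> = p ^ (Suc m choose 2) * q_binom r (Suc m + k - 1) (Suc m)"
    using sum_sorted_words[OF nz, of "Suc m" "k - 1"] k by (simp flip: sum_distrib_left)
  finally show ?thesis
    by (simp add: pattern_sum_def)
qed

subsection \<open>Pairs as labelled arrangements\<close>

definition graph_list :: "nat \<Rightarrow> (nat \<Rightarrow> nat) \<times> (nat \<Rightarrow> nat) \<Rightarrow> (nat \<times> nat) list" where
  "graph_list n x = map (\<lambda>i. (fst x i, snd x i)) [1..<Suc n]"

lemma length_graph_list [simp]: "length (graph_list n x) = n"
  by (simp add: graph_list_def)

lemma graph_list_nth: "i < n \<Longrightarrow> graph_list n x ! i = (fst x (Suc i), snd x (Suc i))"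
  by (simp add: graph_list_def del: upt_Suc)

text \<open>Injectivity rests on the fixed values outside \<open>{1..n}\<close>: the identity for
  the permutation and \<open>undefined\<close> for the word.\<close>

lemma bij_betw_graph_list: "bij_betw (graph_list n) (wreath k n) (labelled k {1..n})"
proof (rule bij_betwI')
  fix x y assume xy: "x \<in> wreath k n" "y \<in> wreath k n"
  show "graph_list n x = graph_list n y \<longleftrightarrow> x = y"
  proof
    assume eq: "graph_list n x = graph_list n y"
    have on: "fst x i = fst y i \<and> snd x i = snd y i" if "i \<in> {1..n}" for i
      using arg_cong[OF eq, of "\<lambda>zs. zs ! (i - 1)"] that
      by (auto simp: graph_list_nth Suc_le_eq)
    have "fst x = fst y"
    proof
      fix i show "fst x i = fst y i"
        using on[of i] xy by (cases "i \<in> {1..n}") (auto simp: wreath_def permutes_def)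
    qed
    moreover have "snd x = snd y"
    proof
      fix i
      have "snd x \<in> {1..n} \<rightarrow>\<^sub>E {0..<k}" "snd y \<in> {1..n} \<rightarrow>\<^sub>E {0..<k}"
        using xy by (auto simp: wreath_def)
      then show "snd x i = snd y i"
        using on[of i] by (metis PiE_arb)
    qed
    ultimately show "x = y" by (rule prod_eqI)
  qed simp
next
  fix x assume x: "x \<in> wreath k n"
  then have perm: "fst x permutes {1..n}" and snd: "snd x \<in> {1..n} \<rightarrow>\<^sub>E {0..<k}"
    by (auto simp: wreath_def)
  have set: "set (graph_list n x) = (\<lambda>i. (fst x i, snd x i)) ` {1..n}"
    by (simp add: graph_list_def atLeastLessThanSuc_atLeastAtMost del: upt_Suc)
  have "map fst (graph_list n x) = map (fst x) [1..<Suc n]"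
    by (simp add: graph_list_def del: upt_Suc)
  moreover have "distinct (map (fst x) [1..<Suc n])"
    unfolding distinct_map using permutes_inj_on[OF perm] by simp
  moreover have "fst ` set (graph_list n x) = {1..n}"
    unfolding set image_image using permutes_image[OF perm] by simp
  moreover have "snd ` set (graph_list n x) \<subseteq> {..<k}"
    unfolding set image_image using PiE_mem[OF snd] by auto
  ultimately show "graph_list n x \<in> labelled k {1..n}"
    by (simp add: labelled_def)
next
  fix zs assume zs: "zs \<in> labelled k {1..n}"
  have len: "length zs = n"
    using labelled_length[OF zs] by simp
  define \<sigma> where "\<sigma> i = (if i \<in> {1..n} then fst (zs ! (i - 1)) else i)" for i
  define w where "w = restrict (\<lambda>i. snd (zs ! (i - 1))) {1..n}"
  have eq: "zs = graph_list n (\<sigma>, w)"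
    by (rule nth_equalityI) (auto simp: len graph_list_nth \<sigma>_def w_def)
  have "distinct (map fst zs)" and img: "fst ` set zs = {1..n}"
    using zs by (auto simp: labelled_def)
  moreover have "map fst zs = map \<sigma> [1..<Suc n]"
    by (subst eq) (simp add: graph_list_def del: upt_Suc)
  ultimately have "inj_on \<sigma> {1..n}"
    unfolding distinct_map by (metis distinct_map atLeastLessThanSuc_atLeastAtMost atLeastLessThan_upt)
  moreover have "\<sigma> ` {1..n} = {1..n}"
  proof -
    have "fst ` set zs = \<sigma> ` {1..n}"
      by (subst eq)
        (simp add: graph_list_def image_image atLeastLessThanSuc_atLeastAtMost del: upt_Suc)
    then show ?thesis using img by simp
  qed
  ultimately have "\<sigma> permutes {1..n}"
    by (intro bij_imp_permutes) (auto simp: bij_betw_def \<sigma>_def)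
  moreover have "w \<in> {1..n} \<rightarrow>\<^sub>E {0..<k}"
  proof -
    have "snd (zs ! (i - 1)) < k" if "i \<in> {1..n}" for i
    proof -
      have "zs ! (i - 1) \<in> set zs" using that len by (intro nth_mem) auto
      then show ?thesis using zs by (auto simp: labelled_def)
    qed
    then show ?thesis by (auto simp: w_def)
  qed
  ultimately have "(\<sigma>, w) \<in> wreath k n" by (simp add: wreath_def)
  then show "\<exists>x\<in>wreath k n. zs = graph_list n x" using eq by blast
qed

lemma card_pairs_Suc:
  "card {(a, b). 1 \<le> a \<and> a < b \<and> b \<le> Suc n \<and> R a b} =
     card {(a, b). 1 \<le> a \<and> a < b \<and> b \<le> n \<and> R a b} + card {a \<in> {1..n}. R a (Suc n)}"
proof -
  have fin: "finite {(a, b). 1 \<le> a \<and> a < b \<and> b \<le> n \<and> R a b}"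
    by (rule finite_subset[of _ "{1..n} \<times> {1..n}"]) auto
  have "{(a, b). 1 \<le> a \<and> a < b \<and> b \<le> Suc n \<and> R a b} =
      {(a, b). 1 \<le> a \<and> a < b \<and> b \<le> n \<and> R a b} \<union> (\<lambda>a. (a, Suc n)) ` {a \<in> {1..n}. R a (Suc n)}"
    by (auto simp: le_Suc_eq)
  then show ?thesis
    using fin by (simp, subst card_Un_disjoint) (auto simp: card_image inj_on_def)
qed

text \<open>Induction appends the last letter although \<open>weight\<close> recurses on the first
  one; \<open>weight_append\<close> bridges the two, and the cross term counts the new
  pairs.\<close>

lemma weight_graph_list:
  assumes "inj_on \<sigma> {1..n}"
  shows "weight p q r (graph_list n (\<sigma>, w)) =
    q ^ inv_stat n \<sigma> * p ^ coinv_stat n \<sigma> * r ^ word_sum n w"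
  using assms
proof (induction n)
  case 0
  have "{(a, b). 1 \<le> a \<and> a < b \<and> b \<le> (0::nat) \<and> R a b} = {}" for R
    by auto
  then show ?case
    unfolding inv_stat_def coinv_stat_def by (simp only:) (simp add: graph_list_def word_sum_def)
next
  case (Suc n)
  have inj: "inj_on \<sigma> {1..n}"
    using Suc.prems by (rule inj_on_subset) auto
  have gl: "graph_list (Suc n) (\<sigma>, w) = graph_list n (\<sigma>, w) @ [(\<sigma> (Suc n), w (Suc n))]"
    by (simp add: graph_list_def)
  have "map fst (graph_list (Suc n) (\<sigma>, w)) = map \<sigma> [1..<Suc (Suc n)]"
    by (simp add: graph_list_def del: upt_Suc)
  then have dist: "distinct (map fst (graph_list n (\<sigma>, w) @ [(\<sigma> (Suc n), w (Suc n))]))"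
    unfolding gl[symmetric] using Suc.prems
    by (simp add: distinct_map atLeastLessThanSuc_atLeastAtMost del: upt_Suc)
  have img: "fst ` set (graph_list n (\<sigma>, w)) = \<sigma> ` {1..n}"
    by (simp add: graph_list_def image_image atLeastLessThanSuc_atLeastAtMost del: upt_Suc)
  \<comment> \<open>\<open>pair_weight\<close> would also return \<open>q\<close> for equal values;
    injectivity excludes this, so \<open>q\<close> marks strict inversions only.\<close>
  have ne: "\<sigma> a \<noteq> \<sigma> (Suc n)" if "a \<in> {1..n}" for a
    using inj_onD[OF Suc.prems, of a "Suc n"] that by auto
  have "cross_weight p q (\<sigma> ` {1..n}) {\<sigma> (Suc n)} = (\<Prod>a\<in>{1..n}. pair_weight p q (\<sigma> a) (\<sigma> (Suc n)))"
    unfolding cross_weight_def by (subst prod.reindex[OF inj]) simp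
  also have "\<dots> = (\<Prod>a\<in>{1..n}. (if \<sigma> a > \<sigma> (Suc n) then q else 1) * (if \<sigma> a < \<sigma> (Suc n) then p else 1))"
  proof (rule prod.cong)
    fix a assume "a \<in> {1..n}"
    from ne[OF this] show "pair_weight p q (\<sigma> a) (\<sigma> (Suc n)) =
        (if \<sigma> a > \<sigma> (Suc n) then q else 1) * (if \<sigma> a < \<sigma> (Suc n) then p else 1)"
      by (auto simp: pair_weight_def)
  qed simp
  also have "\<dots> = q ^ card {a \<in> {1..n}. \<sigma> a > \<sigma> (Suc n)} * p ^ card {a \<in> {1..n}. \<sigma> a < \<sigma> (Suc n)}"
    by (simp add: prod.distrib flip: prod.inter_filter)
  finally have cw: "cross_weight p q (\<sigma> ` {1..n}) {\<sigma> (Suc n)} =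
      q ^ card {a \<in> {1..n}. \<sigma> a > \<sigma> (Suc n)} * p ^ card {a \<in> {1..n}. \<sigma> a < \<sigma> (Suc n)}" .
  show ?case
    using cw unfolding gl weight_append[OF dist] Suc.IH[OF inj] img inv_stat_def coinv_stat_def
      card_pairs_Suc by (simp add: word_sum_def power_add mult_ac)
qed

section \<open>From rise sets to rise words\<close>

definition pattern_of :: "nat \<Rightarrow> nat set \<Rightarrow> bool list" where
  "pattern_of n S = map (\<lambda>i. Suc i \<in> S) [0..<n - 1]"

lemma rises_graph_list: "rises (graph_list n (\<sigma>, w)) = pattern_of n (Ris n \<sigma> w)"
  by (rule nth_equalityI)
    (auto simp: pattern_of_def rises_nth graph_list_nth rise_def Ris_def)

lemma pattern_of_eq_iff:
  assumes "S \<subseteq> {1..<n}" "S' \<subseteq> {1..<n}"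
  shows "pattern_of n S = pattern_of n S' \<longleftrightarrow> S = S'"
proof
  assume eq: "pattern_of n S = pattern_of n S'"
  have "i \<in> S \<longleftrightarrow> i \<in> S'" if "i \<in> {1..<n}" for i
    using arg_cong[OF eq, of "\<lambda>u. u ! (i - 1)"] that by (auto simp: pattern_of_def)
  then show "S = S'" using assms by blast
qed simp

text \<open>The graph bijection turns a prescribed rise set into a prescribed rise word. For
  \<open>n \<ge> 1\<close> that word has length \<open>n - 1\<close>, as \<open>pattern_sum\<close>
  expects.\<close>

lemma sum_Ris_eq:
  assumes "S \<subseteq> {1..<n}" "n \<ge> 1" 
  shows "(\<Sum>(\<sigma>, w) | (\<sigma>, w) \<in> wreath k n \<and> Ris n \<sigma> w = S.
      q ^ inv_stat n \<sigma> * p ^ coinv_stat n \<sigma> * r ^ word_sum n w) / pq_fact p q n =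
    pattern_sum p q r k (pattern_of n S)"
proof -
  have "(\<Sum>x | x \<in> wreath k n \<and> rises (graph_list n x) = pattern_of n S. weight p q r (graph_list n x)) =
      (\<Sum>zs | zs \<in> labelled k {1..n} \<and> rises zs = pattern_of n S. weight p q r zs)"
  proof (rule sum.reindex_bij_betw)
    show "bij_betw (graph_list n) {x. x \<in> wreath k n \<and> rises (graph_list n x) = pattern_of n S}
        {zs. zs \<in> labelled k {1..n} \<and> rises zs = pattern_of n S}"
      using bij_betw_graph_list[of n k] unfolding bij_betw_def
      by (auto intro: inj_on_subset)
  qed
  moreover have "{(\<sigma>, w). (\<sigma>, w) \<in> wreath k n \<and> Ris n \<sigma> w = S} =
      {x. x \<in> wreath k n \<and> rises (graph_list n x) = pattern_of n S}"
  proof -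
    have "pattern_of n (Ris n \<sigma> w) = pattern_of n S \<longleftrightarrow> Ris n \<sigma> w = S" for \<sigma> w
      by (rule pattern_of_eq_iff) (use assms in \<open>auto simp: Ris_def\<close>)
    then show ?thesis
      by (auto simp: rises_graph_list)
  qed
  moreover have "q ^ inv_stat n \<sigma> * p ^ coinv_stat n \<sigma> * r ^ word_sum n w =
      weight p q r (graph_list n (\<sigma>, w))" if "(\<sigma>, w) \<in> wreath k n" for \<sigma> w
    using that by (subst weight_graph_list) (auto simp: wreath_def permutes_inj_on)
  ultimately have "(\<Sum>(\<sigma>, w) | (\<sigma>, w) \<in> wreath k n \<and> Ris n \<sigma> w = S.
      q ^ inv_stat n \<sigma> * p ^ coinv_stat n \<sigma> * r ^ word_sum n w) =
      total p q r k {1..n} (\<lambda>v. v = pattern_of n S)"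
    unfolding total_def by (smt (verit) sum.cong mem_Collect_eq case_prod_beta prod.collapse)
  then show ?thesis
    using assms by (simp add: pattern_sum_def pattern_of_def)
qed

lemma weight_gf_nth:
  assumes fin: "finite I" and n: "n \<ge> 1"
    and A: "A n = {(\<sigma>, w) \<in> wreath k n. Ris n \<sigma> w \<in> S ` I}"
    and inj: "inj_on S I" and S: "\<And>x. x \<in> I \<Longrightarrow> S x \<subseteq> {1..<n}"
  shows "weight_gf p q r A $ n = (\<Sum>x\<in>I. pattern_sum p q r k (pattern_of n (S x)))"
proof -
  let ?f = "\<lambda>(\<sigma>, w). q ^ inv_stat n \<sigma> * p ^ coinv_stat n \<sigma> * r ^ word_sum n w"
  let ?B = "\<lambda>x. {(\<sigma>, w). (\<sigma>, w) \<in> wreath k n \<and> Ris n \<sigma> w = S x}"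
  have "finite (wreath k n)"
    by (simp add: wreath_def finite_permutations finite_PiE)
  then have finB: "finite (?B x)" for x
    by (rule rev_finite_subset) auto
  have "A n = (\<Union>x\<in>I. ?B x)"
    unfolding A by auto
  then have "sum ?f (A n) = (\<Sum>x\<in>I. sum ?f (?B x))"
    using fin finB inj by (simp, subst sum.UNION_disjoint) (auto simp: inj_on_def)
  then show ?thesis
    using sum_Ris_eq[OF S n, where k = k and p = p and q = q and r = r]
    by (simp add: weight_gf_def sum_divide_distrib[of _ I])
qed

text \<open>A rise word of length \<open>i + 2 + j\<close> belongs to \<open>n = i + j + 3\<close>,
  which explains \<open>fps_X ^ 3\<close>.\<close>

lemma weight_gf_U:
  "weight_gf p q r (\<lambda>n. U_set n k) = fps_X ^ 3 * diag_sum (\<lambda>i. Abs_fps (\<lambda>j.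
     pattern_sum p q r k (replicate i False @ replicate 2 True @ replicate j False)))"
  (is "_ = _ * diag_sum ?f")
proof (rule fps_ext)
  fix n
  show "weight_gf p q r (\<lambda>n. U_set n k) $ n = (fps_X ^ 3 * diag_sum ?f) $ n"
  proof (cases "n < 3")
    case True
    then have "U_set n k = {}" by (auto simp: U_set_def)
    then show ?thesis using True by (simp add: weight_gf_def fps_X_power_mult_nth)
  next
    case False
    then obtain m where n: "n = m + 3"
      by (metis add.commute le_Suc_ex not_less)
    have pat: "pattern_of n {i + 1, i + 2} = replicate i False @ replicate 2 True @ replicate (m - i) False"
      if "i \<le> m" for i
      by (rule nth_equalityI)
        (use that in \<open>auto simp: pattern_of_def n nth_append nth_Cons' numeral_2_eq_2\<close>)
    have "weight_gf p q r (\<lambda>n. U_set n k) $ n =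
        (\<Sum>i\<in>{..m}. pattern_sum p q r k (pattern_of n {i + 1, i + 2}))"
    proof (rule weight_gf_nth)
      have "(\<exists>s. 1 \<le> s \<and> s + 2 \<le> n \<and> R = {s, s + 1}) \<longleftrightarrow> R \<in> (\<lambda>i. {i + 1, i + 2}) ` {..m}" for R
      proof
        assume "\<exists>s. 1 \<le> s \<and> s + 2 \<le> n \<and> R = {s, s + 1}"
        then obtain s where "1 \<le> s" "s + 2 \<le> n" "R = {s, s + 1}" by blast
        then show "R \<in> (\<lambda>i. {i + 1, i + 2}) ` {..m}"
          by (intro image_eqI[of _ _ "s - 1"]) (auto simp: n)
      next
        assume "R \<in> (\<lambda>i. {i + 1, i + 2}) ` {..m}"
        then obtain i where "i \<le> m" "R = {i + 1, i + 2}" by auto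
        then show "\<exists>s. 1 \<le> s \<and> s + 2 \<le> n \<and> R = {s, s + 1}"
          by (intro exI[of _ "i + 1"]) (auto simp: n)
      qed
      then show "U_set n k = {(\<sigma>, w) \<in> wreath k n. Ris n \<sigma> w \<in> (\<lambda>i. {i + 1, i + 2}) ` {..m}}"
        unfolding U_set_def by simp
      show "inj_on (\<lambda>i::nat. {i + 1, i + 2}) {..m}"
        by (auto simp: inj_on_def doubleton_eq_iff)
    qed (auto simp: n)
    also have "\<dots> = (\<Sum>i\<in>{..m}. ?f i $ (m - i))"
      by (rule sum.cong) (use pat in auto)
    finally show ?thesis
      by (simp add: fps_X_power_mult_nth n diag_sum_nth)
  qed
qed

text \<open>Non-adjacent rises are separated by a nonempty run, hence \<open>l + 1\<close>. The rise
  word has length \<open>i + l + j + 3\<close>, so \<open>n = i + l + j + 4\<close>.\<close>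

lemma weight_gf_V:
  "weight_gf p q r (\<lambda>n. V_set n k) = fps_X ^ 4 * diag_sum (\<lambda>i. diag_sum (\<lambda>l. Abs_fps (\<lambda>j.
     pattern_sum p q r k
       (replicate i False @ [True] @ replicate (l + 1) False @ [True] @ replicate j False))))"
  (is "_ = _ * diag_sum (\<lambda>i. diag_sum (?f i))")
proof (rule fps_ext)
  fix n
  \<comment> \<open>\<open>V_set\<close> states no bounds on \<open>i\<close> and \<open>j\<close>;
    they follow from membership in the rise set.\<close>
  have Ris: "1 \<le> i \<and> j < n" if "Ris n \<sigma> w = {i, j}" for \<sigma> w i j
  proof -
    have "i \<in> Ris n \<sigma> w" "j \<in> Ris n \<sigma> w" using that by auto
    then show ?thesis by (auto simp: Ris_def)
  qed
  show "weight_gf p q r (\<lambda>n. V_set n k) $ n = (fps_X ^ 4 * diag_sum (\<lambda>i. diag_sum (?f i))) $ n"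
  proof (cases "n < 4")
    case True
    have False if V: "(\<sigma>, w) \<in> V_set n k" for \<sigma> w
    proof -
      obtain i j where "i + 2 \<le> j" "Ris n \<sigma> w = {i, j}"
        using V by (auto simp: V_set_def)
      then show False using Ris[of \<sigma> w i j] True by simp
    qed
    then have "V_set n k = {}" by auto
    then show ?thesis using True by (simp add: weight_gf_def fps_X_power_mult_nth)
  next
    case False
    then obtain m where n: "n = m + 4"
      by (metis add.commute le_Suc_ex not_less)
    define I where "I = (SIGMA i:{..m}. {..m - i})"
    \<comment> \<open>After \<open>i\<close> letters \<open>False\<close> comes the rise
      \<open>i + 1\<close>; another \<open>l + 1\<close> of them put the second rise at
      \<open>i + l + 3\<close>.\<close>
    define S :: "nat \<times> nat \<Rightarrow> nat set" where "S = (\<lambda>(i, l). {i + 1, i + l + 3})"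
    have pat: "pattern_of n {i + 1, i + l + 3} =
        replicate i False @ [True] @ replicate (l + 1) False @ [True] @ replicate (m - i - l) False"
      if "i \<le> m" "l \<le> m - i" for i l
      by (rule nth_equalityI)
        (use that in \<open>auto simp: pattern_of_def n nth_append nth_Cons'\<close>)
    have "weight_gf p q r (\<lambda>n. V_set n k) $ n =
        (\<Sum>x\<in>I. pattern_sum p q r k (pattern_of n (S x)))"
    proof (rule weight_gf_nth)
      have "(\<exists>i j. i + 2 \<le> j \<and> Ris n \<sigma> w = {i, j}) \<longleftrightarrow> Ris n \<sigma> w \<in> S ` I" for \<sigma> w
      proof
        assume "\<exists>i j. i + 2 \<le> j \<and> Ris n \<sigma> w = {i, j}"
        then obtain i j where ij: "i + 2 \<le> j" "Ris n \<sigma> w = {i, j}" by blast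
        then have "1 \<le> i" "j < n" using Ris[of \<sigma> w i j] by auto
        then have "(i - 1, j - i - 2) \<in> I" "S (i - 1, j - i - 2) = {i, j}"
          using ij(1) by (auto simp: n S_def I_def)
        then show "Ris n \<sigma> w \<in> S ` I"
          unfolding ij(2) by (metis imageI)
      next
        assume "Ris n \<sigma> w \<in> S ` I"
        then obtain i l where "Ris n \<sigma> w = {i + 1, i + l + 3}" by (auto simp: S_def)
        then show "\<exists>i j. i + 2 \<le> j \<and> Ris n \<sigma> w = {i, j}"
          by (intro exI[of _ "i + 1"] exI[of _ "i + l + 3"]) auto
      qed
      then show "V_set n k = {(\<sigma>, w) \<in> wreath k n. Ris n \<sigma> w \<in> S ` I}"
        unfolding V_set_def by simp
      show "inj_on S I"
        by (auto simp: inj_on_def S_def doubleton_eq_iff)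
    qed (auto simp: n I_def S_def)
    also have "\<dots> = (\<Sum>(i, l)\<in>I. ?f i l $ (m - i - l))"
      by (rule sum.cong) (use pat in \<open>auto simp: S_def I_def\<close>)
    also have "\<dots> = (\<Sum>i\<le>m. \<Sum>l\<le>m - i. ?f i l $ (m - i - l))"
      unfolding I_def by (subst sum.Sigma) auto
    finally show ?thesis
      by (simp add: fps_X_power_mult_nth n diag_sum_nth)
  qed
qed

section \<open>The two closed forms\<close>

theorem theorem15:
  fixes p q r :: "'a::field_char_0" and k :: nat
  assumes k: "k \<ge> 2"
    and pq_nonzero: "\<And>n. n \<ge> 1 \<Longrightarrow> pq_num p q n \<noteq> 0"
    and r_nonzero: "\<And>n. n \<ge> 1 \<Longrightarrow> q_num r n \<noteq> 0"
  shows
    "weight_gf p q r (\<lambda>n. U_set n k) =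
       ((fps_const (q_num r k) * fps_X - 1) + P_fps p q r k - G_fps p q r k)
         / (P_fps p q r k) ^ 2
     \<and>
     weight_gf p q r (\<lambda>n. V_set n k) =
       ((G_fps p q r k) ^ 2 +
          P_fps p q r k *
            (H_fps p q r k + G_fps p q r k - (fps_const (q_num r k) * fps_X - 1) - P_fps p q r k))
         / (P_fps p q r k) ^ 3"
proof -
  interpret ribbon "pattern_sum p q r k"
    by unfold_locales (rule pattern_sum_mult[OF pq_nonzero])
  have base: "base_coeff p q r k n = b n" if n: "n \<ge> 1" for n
  proof -
    obtain m where "n = Suc m" using n by (cases n) auto
    then show ?thesis
      using pattern_sum_trues[OF r_nonzero, of k p q m] k by (simp add: b_def base_coeff_def)
  qed
  have b0: "b 0 = 1" by (simp add: b_def)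
  \<comment> \<open>This coefficient is why \<open>q_num r k\<close> times \<open>fps_X\<close>
    appears: it cancels the linear term of \<open>P\<close>.\<close>
  have b1: "b 1 = - q_num r k"
  proof -
    have "q_fact r (k - 1) \<noteq> 0" using r_nonzero by (simp add: q_fact_def)
    moreover have "q_fact r k = q_num r k * q_fact r (k - 1)"
      using k by (cases k) (simp_all add: q_fact_def mult.commute)
    moreover have "q_fact r 1 = 1"
      by (simp add: q_fact_def q_num_def)
    ultimately have "q_binom r k 1 = q_num r k"
      by (simp add: q_binom_def)
    then show ?thesis
      using base[of 1] by (simp add: base_coeff_def numeral_2_eq_2 pq_fact_def pq_num_def)
  qed
  have P: "P_fps p q r k = P"
    by (rule fps_ext) (auto simp: P_fps_def P_def base b0 not_le)
  have G: "G_fps p q r k = G"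
    by (rule fps_ext) (auto simp: G_fps_def G_def base not_le less_2_cases_iff)
  have P_nz: "P \<noteq> 0"
    using b0 by (metis P_def fps_nth_Abs_fps fps_zero_nth zero_neq_one)
  have small: "n = 0 \<or> n = 1 \<or> n = 2 \<or> (\<exists>m. n = m + 3)" for n :: nat
    by presburger
  \<comment> \<open>For \<open>n \<ge> 3\<close> both coefficients are
    \<open>- (n - 2) * b n\<close>, written as \<open>b n - (n - 1) * b n\<close> on the right. The
    term \<open>[k] t - 1\<close> cancels degrees 0 and 1, and degree 2 vanishes by itself.\<close>
  have "fps_X ^ 3 * Abs_fps (\<lambda>n. of_nat (n + 1) * (- 1) ^ n * pattern_sum p q r k (T (n + 2))) =
      (fps_const (q_num r k) * fps_X - 1) + P - G" (is "?U = ?U'")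
  proof (rule fps_ext)
    fix n
    show "?U $ n = ?U' $ n"
      using small[of n] b0 b1
      by (auto simp: fps_X_power_mult_nth P_def G_def b_def[of "Suc (Suc (Suc _))"] numeral_3_eq_3 algebra_simps)
  qed
  then have U: "weight_gf p q r (\<lambda>n. U_set n k) * P ^ 2 = ?U'"
    unfolding weight_gf_U mult.assoc adjacent_pair_gf by simp
  \<comment> \<open>Pascal's rule gives
    \<open>- ((n - 2) choose 2) = - ((n - 1) choose 2) + (n - 1) - 1\<close> for
    \<open>n \<ge> 3\<close>, whose three terms come from \<open>H\<close>, \<open>G\<close> and
    \<open>- P\<close>; the low degrees cancel as before.\<close>
  have K: "- Abs_fps (\<lambda>n. of_nat ((n - 2) choose 2) * b n) =
      H_fps p q r k + G - (fps_const (q_num r k) * fps_X - 1) - P" (is "?K = ?K'")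
  proof (rule fps_ext)
    fix n
    show "?K $ n = ?K' $ n"
      using small[of n] b0 b1
      by (auto simp: H_fps_def P_def G_def base numeral_2_eq_2 algebra_simps)
  qed
  have V: "weight_gf p q r (\<lambda>n. V_set n k) * P ^ 3 = G ^ 2 + P * ?K'"
    unfolding weight_gf_V separated_pair_gf K[symmetric] by simp
  show ?thesis
    \<comment> \<open>Each numerator becomes the generating function times a power of
      \<open>P\<close>, which cancels in the division since \<open>P \<noteq> 0\<close>.\<close>
    unfolding P G U[symmetric] V[symmetric] using P_nz by simp
qed

end
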